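(* Let $X$ be a smooth Banach space, let $A:X\rightrightarrows X^*$ and let $\alpha,\beta\in\mathbb{R}$. Then: (i) $A$ is $\alpha$-monotone if and only if $A-\beta J$ is $(\alpha-\beta)$-monotone. (ii) $A$ is maximally $\alpha$-monotone if and only if $A-\beta J$ is maximally $(\alpha-\beta)$-monotone. Consequently, $A$ is (respectively, maximally) $\alpha$-monotone if and only if $A-\alpha J$ is (respectively, maximally) monotone.
   Context: All Banach spaces are real. $J:X\to X^*$ is the normalized duality mapping, $\langle x,Jx\rangle=\|x\|^2=\|Jx\|^2$ (single-valued since $X$ is smooth). For $\alpha\in\mathbb{R}$, $A:X\rightrightarrows X^*$ is $\alpha$-monotone if $\langle x-y,u-v\rangle\ge\alpha\langle x-y,Jx-Jy\rangle$ for all $(x,u),(y,v)\in\mathrm{gra}\,A$. It is maximally $\alpha$-monotone if it is $\alpha$-monotone and no $\alpha$-monotone operator $B:X\rightrightarrows X^*$ has a graph properly containing $\mathrm{gra}\,A$. (Maximally) monotone means (maximally) $0$-monotone. *)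

theory Defs
  imports "HOL-Analysis.Analysis"
begin

type_synonym 'a dual = "'a \<Rightarrow>\<^sub>L real"

text \<open>A real normed space is smooth if its norm is Gateaux differentiable away from the origin.
  Requiring the two-sided limit in every direction is enough: by convexity of the norm, the
  directional derivative is then automatically linear and bounded
  (see \<open>ex1_duality\<close> below).\<close>

definition smooth_space :: "'a::real_normed_vector itself \<Rightarrow> bool" where
  "smooth_space _ \<longleftrightarrow> (\<forall>(x::'a) y. x \<noteq> 0 \<longrightarrow>
     (\<exists>l. ((\<lambda>t::real. (norm (x + t *\<^sub>R y) - norm x) / t) \<longlongrightarrow> l) (at 0)))"

text \<open>The description operator is justified on smooth spaces by \<open>ex1_duality\<close>.\<close>

definition duality_map :: "'a::real_normed_vector \<Rightarrow> 'a dual" where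
  "duality_map x = (THE f. blinfun_apply f x = (norm x)\<^sup>2 \<and> (norm f)\<^sup>2 = (norm x)\<^sup>2)"

definition gra :: "('a::real_normed_vector \<Rightarrow> 'a dual set) \<Rightarrow> ('a \<times> 'a dual) set" where
  "gra A = {(x, u). u \<in> A x}"

definition alpha_monotone :: "real \<Rightarrow> ('a::real_normed_vector \<Rightarrow> 'a dual set) \<Rightarrow> bool" where
  "alpha_monotone \<alpha> A \<longleftrightarrow> (\<forall>(x, u) \<in> gra A. \<forall>(y, v) \<in> gra A.
     blinfun_apply (u - v) (x - y) \<ge> \<alpha> * blinfun_apply (duality_map x - duality_map y) (x - y))"

definition max_alpha_monotone :: "real \<Rightarrow> ('a::real_normed_vector \<Rightarrow> 'a dual set) \<Rightarrow> bool" where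
  "max_alpha_monotone \<alpha> A \<longleftrightarrow> alpha_monotone \<alpha> A \<and> \<not> (\<exists>B. alpha_monotone \<alpha> B \<and> gra A \<subset> gra B)"

definition monotone_operator :: "('a::real_normed_vector \<Rightarrow> 'a dual set) \<Rightarrow> bool" where
  "monotone_operator A \<longleftrightarrow> alpha_monotone 0 A"

definition max_monotone_operator :: "('a::real_normed_vector \<Rightarrow> 'a dual set) \<Rightarrow> bool" where
  "max_monotone_operator A \<longleftrightarrow> max_alpha_monotone 0 A"

text \<open>The operator \<open>A - \<beta> J\<close>, where \<open>J\<close> is the duality map.\<close>

definition minus_duality_map :: "('a::real_normed_vector \<Rightarrow> 'a dual set) \<Rightarrow> real \<Rightarrow> 'a \<Rightarrow> 'a dual set" where
  "minus_duality_map A \<beta> x = {u - \<beta> *\<^sub>R duality_map x | u. u \<in> A x}"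

lemma ex1_duality:
  fixes x :: "'a::real_normed_vector"
  assumes "smooth_space TYPE('a)"
  shows "\<exists>!f :: 'a dual. blinfun_apply f x = (norm x)\<^sup>2 \<and> (norm f)\<^sup>2 = (norm x)\<^sup>2"
proof (cases "x = 0")
  case True
  then show ?thesis by (auto intro!: ex1I[of _ 0])
next
  case False
  define q where "q y t = (norm (x + t *\<^sub>R y) - norm x) / t" for y and t :: real
  have "\<forall>y. \<exists>l. (q y \<longlongrightarrow> l) (at 0)"
    using assms False unfolding smooth_space_def q_def by blast
  then obtain p where p: "(q y \<longlongrightarrow> p y) (at 0)" for y by metis
  have pr: "(q y \<longlongrightarrow> p y) (at_right 0)" and pl: "(q y \<longlongrightarrow> p y) (at_left 0)" for y
    using p[of y] by (simp_all add: filterlim_at_split)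
  have scale: "p (c *\<^sub>R y) = c * p y" for c y
  proof (cases "c = 0")
    case True
    then have "q (c *\<^sub>R y) = (\<lambda>t. 0)" by (auto simp: q_def)
    then show ?thesis using p[of "c *\<^sub>R y"] True
      using LIM_unique[OF p[of "c *\<^sub>R y"], of 0] by simp
  next
    case c: False
    have l: "filterlim (\<lambda>t. c * t) (at 0) (at (0::real))"
      unfolding filterlim_at using c
      by (auto simp: eventually_at_filter intro!: tendsto_eq_intros)
    have "((\<lambda>t. c * q y (c * t)) \<longlongrightarrow> c * p y) (at 0)"
      by (intro tendsto_intros filterlim_compose[OF p l])
    moreover have "c * q y (c * t) = q (c *\<^sub>R y) t" for t
      using c by (cases "t = 0") (auto simp: q_def mult.commute)
    ultimately show ?thesis using LIM_unique[OF p[of "c *\<^sub>R y"]] by simp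
  qed
  have sub: "p (y + z) \<le> p y + p z" for y z
  proof -
    have q: "q (y + z) t \<le> (q (2 *\<^sub>R y) t + q (2 *\<^sub>R z) t) / 2" if "t > 0" for t
    proof -
      have "2 *\<^sub>R (x + t *\<^sub>R (y + z)) = (x + t *\<^sub>R (2 *\<^sub>R y)) + (x + t *\<^sub>R (2 *\<^sub>R z))"
        by (simp add: scaleR_2 algebra_simps flip: scaleR_scaleR)
      then have "2 * norm (x + t *\<^sub>R (y + z)) \<le> norm (x + t *\<^sub>R (2 *\<^sub>R y)) + norm (x + t *\<^sub>R (2 *\<^sub>R z))"
        by (metis norm_scaleR norm_triangle_ineq abs_numeral)
      moreover have "(a - n) / t \<le> ((b - n) / t + (c - n) / t) / 2" if "2 * a \<le> b + c" for a b c n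
        using divide_right_mono[of "a - n" "(b + c) / 2 - n" t] that \<open>t > 0\<close>
        by (simp add: diff_divide_distrib add_divide_distrib)
      ultimately show ?thesis unfolding q_def by blast
    qed
    have lim: "((\<lambda>t. (q (2 *\<^sub>R y) t + q (2 *\<^sub>R z) t) / 2) \<longlongrightarrow> (p (2 *\<^sub>R y) + p (2 *\<^sub>R z)) / 2) (at_right 0)"
      by (intro tendsto_intros pr) simp
    have "p (y + z) \<le> (p (2 *\<^sub>R y) + p (2 *\<^sub>R z)) / 2"
      by (rule tendsto_le[OF _ lim pr]) (use q in \<open>auto simp: eventually_at_filter\<close>)
    then show ?thesis by (simp add: scale)
  qed
  have neg: "p (- y) = - p y" for y using scale[of "-1" y] by simp
  have add: "p (y + z) = p y + p z" for y z
    using sub[of y z] sub[of "- y" "- z"] neg[of "y + z"] neg[of y] neg[of z] by simp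
  have le: "p y \<le> norm y" for y
  proof (rule tendsto_upperbound[OF pr])
    have "q y t \<le> norm y" if "t > 0" for t
      using norm_triangle_ineq[of x "t *\<^sub>R y"] that by (simp add: q_def field_simps)
    then show "\<forall>\<^sub>F t in at_right 0. q y t \<le> norm y"
      by (auto simp: eventually_at_filter)
  qed simp
  have abs: "\<bar>p y\<bar> \<le> norm y" for y using le[of y] le[of "- y"] neg[of y] by simp
  have bl: "bounded_linear (\<lambda>y. norm x * p y)"
  proof (rule bounded_linear_intro[where K = "norm x"])
    show "norm (norm x * p y) \<le> norm y * norm x" for y
      using mult_right_mono[OF abs[of y] norm_ge_zero[of x]] by (simp add: abs_mult mult.commute)
  qed (simp_all add: add scale distrib_left)
  define f where "f = Blinfun (\<lambda>y. norm x * p y)"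
  have f: "blinfun_apply f y = norm x * p y" for y
    unfolding f_def by (simp add: bounded_linear_Blinfun_apply[OF bl])
  have px: "p x = norm x"
  proof -
    have "\<forall>\<^sub>F t in at_right 0. q x t = norm x"
    proof -
      have "q x t = norm x" if "t > 0" for t
      proof -
        have "x + t *\<^sub>R x = (1 + t) *\<^sub>R x" by (simp add: algebra_simps)
        then have "norm (x + t *\<^sub>R x) = (1 + t) * norm x" using that by simp
        then show ?thesis using that by (simp add: q_def field_simps)
      qed
      then show ?thesis by (auto simp: eventually_at_filter)
    qed
    then have "(q x \<longlongrightarrow> norm x) (at_right 0)" by (rule tendsto_eventually)
    then show ?thesis using tendsto_unique[OF _ pr] by simp
  qed
  have "norm f \<le> norm x"
    by (rule norm_blinfun_bound) (auto simp: f abs_mult intro!: mult_left_mono abs)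
  moreover have "norm x \<le> norm f"
    using norm_blinfun[of f x] False by (simp add: f px)
  ultimately have nf: "norm f = norm x" by simp
  show ?thesis
  proof (rule ex1I[of _ f])
    show "blinfun_apply f x = (norm x)\<^sup>2 \<and> (norm f)\<^sup>2 = (norm x)\<^sup>2"
      by (simp add: f px nf power2_eq_square)
  next
    fix g :: "'a dual"
    assume g: "blinfun_apply g x = (norm x)\<^sup>2 \<and> (norm g)\<^sup>2 = (norm x)\<^sup>2"
    then have ng: "norm g = norm x" by simp
    have gle: "blinfun_apply g y \<le> norm x * p y" for y
    proof (rule tendsto_lowerbound[OF tendsto_mult[OF tendsto_const pr]])
      have "blinfun_apply g y \<le> norm x * q y t" if "t > 0" for t
      proof -
        have "blinfun_apply g (x + t *\<^sub>R y) \<le> norm x * norm (x + t *\<^sub>R y)"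
          using norm_blinfun[of g "x + t *\<^sub>R y"] ng by simp
        then have "t * blinfun_apply g y \<le> norm x * (norm (x + t *\<^sub>R y) - norm x)"
          using g by (simp add: blinfun.add_right blinfun.scaleR_right algebra_simps power2_eq_square)
        then show ?thesis using that by (simp add: q_def field_simps)
      qed
      then show "\<forall>\<^sub>F t in at_right 0. blinfun_apply g y \<le> norm x * q y t"
        by (auto simp: eventually_at_filter)
    qed simp
    show "g = f"
    proof (rule blinfun_eqI)
      fix y
      show "blinfun_apply g y = blinfun_apply f y"
        using gle[of y] gle[of "- y"] by (simp add: f neg blinfun.minus_right)
    qed
  qed
qed

lemma
  fixes x :: "'a::real_normed_vector"
  assumes "smooth_space TYPE('a)"
  shows duality_map_apply_self: "blinfun_apply (duality_map x) x = (norm x)\<^sup>2"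
    and norm_duality_map: "(norm (duality_map x))\<^sup>2 = (norm x)\<^sup>2"
  using theI'[OF ex1_duality[OF assms, of x]] unfolding duality_map_def by blast+

end

theory Submission imports Defs begin

text \<open>Write J for \<open>duality_map\<close>. Passing from A to A - \<beta>J replaces each
  graph point (x, u) by (x, u - \<beta> Jx), so both sides of the monotonicity inequality lose the
  same term, \<beta> times the pairing of Jx - Jy with x - y: this is
  \<open>alpha_monotone_minus_duality_map_iff\<close>. The passage is a bijection on operators,
  undone by -\<beta>, and respects strict inclusion of graphs; hence proper extensions correspond
  and maximality carries over.\<close>

lemma minus_duality_map_eq_image:
  "minus_duality_map A \<beta> x = (\<lambda>u. u - \<beta> *\<^sub>R duality_map x) ` A x"
  by (auto simp: minus_duality_map_def)

lemma minus_duality_map_inverse [simp]: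
  "minus_duality_map (minus_duality_map A \<beta>) (- \<beta>) = A"
  "minus_duality_map (minus_duality_map A (- \<beta>)) \<beta> = A"
  by (rule ext, simp add: minus_duality_map_eq_image image_image)+

lemma gra_subset_iff: "gra A \<subseteq> gra B \<longleftrightarrow> (\<forall>x. A x \<subseteq> B x)"
  by (auto simp: gra_def)

text \<open>Over each x the map is a translation by a fixed functional, hence injective, so
  inclusion of images gives back inclusion of the fibres.\<close>

lemma gra_minus_duality_map_subset_iff:
  "gra (minus_duality_map A \<beta>) \<subseteq> gra (minus_duality_map B \<beta>) \<longleftrightarrow> gra A \<subseteq> gra B"
  by (simp add: gra_subset_iff minus_duality_map_eq_image inj_image_subset_iff inj_on_def)

lemma gra_minus_duality_map_psubset_iff:
  "gra (minus_duality_map A \<beta>) \<subset> gra (minus_duality_map B \<beta>) \<longleftrightarrow> gra A \<subset> gra B"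
  by (simp add: less_le_not_le gra_minus_duality_map_subset_iff)

lemma alpha_monotone_minus_duality_map_iff:
  "alpha_monotone (\<alpha> - \<beta>) (minus_duality_map A \<beta>) \<longleftrightarrow> alpha_monotone \<alpha> A"
proof -
  have "(\<alpha> - \<beta>) * blinfun_apply (duality_map x - duality_map y) (x - y)
      \<le> blinfun_apply ((u - \<beta> *\<^sub>R duality_map x) - (v - \<beta> *\<^sub>R duality_map y)) (x - y)
    \<longleftrightarrow> \<alpha> * blinfun_apply (duality_map x - duality_map y) (x - y) \<le> blinfun_apply (u - v) (x - y)"
    for x y :: 'a and u v
    by (simp add: blinfun.add_left blinfun.diff_left blinfun.scaleR_left algebra_simps)
  then show ?thesis
    by (simp add: alpha_monotone_def gra_def minus_duality_map_eq_image split_def)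
       (fastforce simp: image_iff)
qed

lemma max_alpha_monotone_minus_duality_map_iff:
  "max_alpha_monotone (\<alpha> - \<beta>) (minus_duality_map A \<beta>) \<longleftrightarrow> max_alpha_monotone \<alpha> A"
proof -
  \<comment> \<open>A competitor B of A - \<beta>J has the form C - \<beta>J with C = B + \<beta>J,
    by \<open>minus_duality_map_inverse(2)\<close>; then C is a competitor of A. Conversely,
    subtract \<beta>J from a competitor of A.\<close>
  have "(\<exists>B. alpha_monotone (\<alpha> - \<beta>) B \<and> gra (minus_duality_map A \<beta>) \<subset> gra B)
    \<longleftrightarrow> (\<exists>B. alpha_monotone \<alpha> B \<and> gra A \<subset> gra B)"
    by (metis alpha_monotone_minus_duality_map_iff gra_minus_duality_map_psubset_iff
        minus_duality_map_inverse(2))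
  then show ?thesis
    by (simp add: max_alpha_monotone_def alpha_monotone_minus_duality_map_iff)
qed

theorem lemma3p13:
  fixes A :: "'a::banach \<Rightarrow> 'a dual set" and \<alpha> \<beta> :: real
  assumes "smooth_space TYPE('a)"
  shows "(alpha_monotone \<alpha> A \<longleftrightarrow> alpha_monotone (\<alpha> - \<beta>) (minus_duality_map A \<beta>))
    \<and> (max_alpha_monotone \<alpha> A \<longleftrightarrow> max_alpha_monotone (\<alpha> - \<beta>) (minus_duality_map A \<beta>))
    \<and> (alpha_monotone \<alpha> A \<longleftrightarrow> monotone_operator (minus_duality_map A \<alpha>))
    \<and> (max_alpha_monotone \<alpha> A \<longleftrightarrow> max_monotone_operator (minus_duality_map A \<alpha>))"
  \<comment> \<open>The last two equivalences are the case \<beta> = \<alpha>, where the modulus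
    \<alpha> - \<alpha> becomes 0.\<close>
  using alpha_monotone_minus_duality_map_iff[of \<alpha> \<alpha> A]
    max_alpha_monotone_minus_duality_map_iff[of \<alpha> \<alpha> A]
  by (simp add: alpha_monotone_minus_duality_map_iff max_alpha_monotone_minus_duality_map_iff
      monotone_operator_def max_monotone_operator_def)

end
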